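(* Let $d\ge2$ be an integer, let $i\in\{1,\dots,d\}$ and let $c\in\mathbb{Q}$. Then the hyperplane $\{\boldsymbol{x}\in\mathbb{R}^d: x_i=c\}$ (the perpendicular translate of a coordinate hyperplane by the rational number $c$) is of Khintchine type for divergence, but is not of Khintchine type for convergence.
   Context: An approximating function is a non-increasing function $\psi:\mathbb{N}\to[0,\infty)$. A point $\boldsymbol{x}\in\mathbb{R}^d$ is $\psi$-approximable if $\|q\boldsymbol{x}-\boldsymbol{p}\|_\infty<\psi(q)$ holds for infinitely many $(\boldsymbol{p},q)\in\mathbb{Z}^d\times\mathbb{N}$. A manifold $\mathcal{M}\subset\mathbb{R}^d$ is of Khintchine type for divergence if for every approximating function $\psi$ with $\sum_{q}\psi(q)^d=\infty$, almost every point of $\mathcal{M}$ is $\psi$-approximable; it is of Khintchine type for convergence if for every approximating function $\psi$ with $\sum_q\psi(q)^d<\infty$, almost no point of $\mathcal{M}$ is $\psi$-approximable. For a hyperplane, "almost every/no" refers to $(d-1)$-dimensional Lebesgue measure on it. *)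

theory Defs
  imports "HOL-Analysis.Analysis"
begin

text \<open>
  The positive integers are encoded as \<open>nat\<close> with values at 0 ignored, so a function on the
  positive integers is constrained and used on \<open>{1..}\<close> only.
\<close>

definition approximating_function :: "(nat \<Rightarrow> real) \<Rightarrow> bool" where
  "approximating_function \<psi> \<longleftrightarrow> (\<forall>q\<ge>1. 0 \<le> \<psi> q) \<and> antimono_on {1..} \<psi>"

definition approximable :: "(nat \<Rightarrow> real) \<Rightarrow> real ^ 'n \<Rightarrow> bool" where
  "approximable \<psi> x \<longleftrightarrow>
     infinite {(p :: int ^ 'n, q :: nat).
       1 \<le> q \<and> infnorm (real q *\<^sub>R x - (\<chi> j. real_of_int (p $ j))) < \<psi> q}"

text \<open>
  A manifold is represented by its natural measure \<open>\<mu>\<close>, with \<open>space \<mu>\<close> the manifold itself.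
  As the terms are nonnegative, a series diverges to infinity iff it is not summable.
\<close>

definition khintchine_type_divergence :: "(real ^ 'n) measure \<Rightarrow> bool" where
  "khintchine_type_divergence \<mu> \<longleftrightarrow>
     (\<forall>\<psi>. approximating_function \<psi> \<longrightarrow> \<not> summable (\<lambda>q. \<psi> (Suc q) ^ CARD('n)) \<longrightarrow>
        (AE x in \<mu>. approximable \<psi> x))"

definition khintchine_type_convergence :: "(real ^ 'n) measure \<Rightarrow> bool" where
  "khintchine_type_convergence \<mu> \<longleftrightarrow>
     (\<forall>\<psi>. approximating_function \<psi> \<longrightarrow> summable (\<lambda>q. \<psi> (Suc q) ^ CARD('n)) \<longrightarrow>
        (AE x in \<mu>. \<not> approximable \<psi> x))"

definition coord_hyperplane :: "'n::finite \<Rightarrow> real \<Rightarrow> (real ^ 'n) set" where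
  "coord_hyperplane i c = {x. x $ i = c}"

definition coord_hyperplane_embed :: "'n::finite \<Rightarrow> real \<Rightarrow> ('n \<Rightarrow> real) \<Rightarrow> real ^ 'n" where
  "coord_hyperplane_embed i c y = (\<chi> j. if j = i then c else y j)"

text \<open>
  Lebesgue measure in the coordinates other than \<open>i\<close>, carried to the hyperplane by the isometric
  parametrization. It lives on Borel sets; \<open>AE\<close> nevertheless disregards arbitrary subsets of
  null sets, so completing it would not change the notions above.
\<close>

definition coord_hyperplane_measure :: "'n::finite \<Rightarrow> real \<Rightarrow> (real ^ 'n) measure" where
  "coord_hyperplane_measure i c =
     distr (\<Pi>\<^sub>M j\<in>UNIV - {i}. lborel) (restrict_space borel (coord_hyperplane i c))
       (coord_hyperplane_embed i c)"

lemma space_coord_hyperplane_measure [simp]: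
  "space (coord_hyperplane_measure i c) = coord_hyperplane i c"
  by (simp add: coord_hyperplane_measure_def space_restrict_space)

lemma measurable_coord_hyperplane_embed:
  fixes i :: "'n::finite"
  shows "coord_hyperplane_embed i c \<in>
    (\<Pi>\<^sub>M j\<in>UNIV - {i}. lborel) \<rightarrow>\<^sub>M restrict_space borel (coord_hyperplane i c)"
proof (rule measurable_restrict_space2)
  show "coord_hyperplane_embed i c \<in> space (\<Pi>\<^sub>M j\<in>UNIV - {i}. lborel) \<rightarrow> coord_hyperplane i c"
    by (auto simp: coord_hyperplane_embed_def coord_hyperplane_def)
  have "(\<lambda>y. coord_hyperplane_embed i c y \<bullet> b) \<in> borel_measurable (\<Pi>\<^sub>M j\<in>UNIV - {i}. lborel)"
    if "b \<in> Basis" for b :: "real ^ 'n"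
  proof -
    from that obtain k where b: "b = axis k 1"
      by (auto simp: Basis_vec_def)
    show ?thesis
    proof (cases "k = i")
      case True
      then show ?thesis
        by (simp add: b inner_axis coord_hyperplane_embed_def)
    next
      case False
      then have "(\<lambda>y. y k) \<in> (\<Pi>\<^sub>M j\<in>UNIV - {i}. lborel) \<rightarrow>\<^sub>M (lborel :: real measure)"
        by (intro measurable_component_singleton) auto
      with False show ?thesis
        by (simp add: b inner_axis coord_hyperplane_embed_def)
    qed
  qed
  then show "coord_hyperplane_embed i c \<in> borel_measurable (\<Pi>\<^sub>M j\<in>UNIV - {i}. lborel)"
    by (subst borel_measurable_euclidean_space) auto
qed

end

(* With n = d - 1 and c = a/b, Dirichlet's theorem applied to the n numbers b x_j (j \<noteq> i) gives,
   for every N, a multiple q \<le> b N^n of b with |q x - p| < 1/N, the i-th coordinate contributing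
   no error. Hence every point of the hyperplane is \<psi>-approximable as soon as
   \<psi>(b N^n) \<ge> 1/N for infinitely many N (at a rational point the q need not grow with N, but
   multiples of an exact solution do the job). If this condition fails, \<psi>(q) = O(q^(-1/n)) by monotonicity, so the
   sum of \<psi>(q)^(n+1) converges; and \<psi>(q) = (b/q)^(1/n) meets the condition although
   the sum converges. *)

theory Submission
  imports Defs
begin

section \<open>Simultaneous Diophantine approximation on the hyperplane\<close>

lemma infnorm_cart_less_iff:
  fixes x :: "real ^ 'n"
  shows "infnorm x < r \<longleftrightarrow> (\<forall>j. \<bar>x $ j\<bar> < r)"
proof -
  have "{\<bar>x $ j\<bar> | j. j \<in> UNIV} = range (\<lambda>j. \<bar>x $ j\<bar>)"
    by auto
  then have "infnorm x = Max (range (\<lambda>j. \<bar>x $ j\<bar>))"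
    by (simp add: infnorm_cart cSup_eq_Max)
  then show ?thesis
    by simp
qed

text \<open>Carries \<open>Dirichlet_approx_simult\<close>, whose indices are the naturals below a
  bound, along a bijection, so that it applies to the coordinates in
  \<open>UNIV - {i}\<close>.\<close>

lemma Dirichlet_approx_finite:
  fixes \<theta> :: "'a \<Rightarrow> real"
  assumes "finite I" and "N > 0"
  obtains m :: nat and p :: "'a \<Rightarrow> int"
  where "0 < m" "m \<le> N ^ card I" "\<And>j. j \<in> I \<Longrightarrow> \<bar>real m * \<theta> j - of_int (p j)\<bar> < 1 / real N"
proof -
  obtain h where h: "bij_betw h I {0..<card I}"
    using ex_bij_betw_finite_nat[OF \<open>finite I\<close>] by blast
  obtain q p where q: "0 < q" "q \<le> int (N ^ card I)"
    and p: "\<And>k. k < card I \<Longrightarrow> \<bar>of_int q * \<theta> (inv_into I h k) - of_int (p k)\<bar> < 1 / N"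
    using Dirichlet_approx_simult[OF \<open>N > 0\<close>, of "card I" "\<lambda>k. \<theta> (inv_into I h k)"] by blast
  show thesis
  proof
    show "0 < nat q" "nat q \<le> N ^ card I"
      using q by (auto simp: nat_le_iff)
    fix j assume "j \<in> I"
    then have "h j < card I" "inv_into I h (h j) = j"
      using h by (auto simp: bij_betw_def)
    with p[of "h j"] q show "\<bar>real (nat q) * \<theta> j - of_int ((p \<circ> h) j)\<bar> < 1 / real N"
      by simp
  qed
qed

lemma Dirichlet_approx_coord_hyperplane:
  fixes x :: "real ^ 'n"
  assumes "x \<in> coord_hyperplane i (of_int a / real b)" and "b > 0" and "N > 0"
  obtains p :: "int ^ 'n" and q :: nat
  where "1 \<le> q" "q \<le> b * N ^ (CARD('n) - 1)"
    "infnorm (real q *\<^sub>R x - (\<chi> j. real_of_int (p $ j))) < 1 / real N"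
proof -
  obtain m :: nat and p where m: "0 < m" "m \<le> N ^ card (UNIV - {i})"
    and p: "\<And>j. j \<in> UNIV - {i} \<Longrightarrow> \<bar>real m * (real b * x $ j) - of_int (p j)\<bar> < 1 / real N"
    using Dirichlet_approx_finite[of "UNIV - {i}" N "\<lambda>j. real b * x $ j"] \<open>N > 0\<close>
    by (metis finite)
  show thesis
  proof
    show "1 \<le> b * m"
      using m \<open>b > 0\<close> by simp
    show "b * m \<le> b * N ^ (CARD('n) - 1)"
      using m by (simp add: card_Diff_singleton)
    \<comment> \<open>In coordinate \<open>i\<close> the numerator \<open>a * m\<close> is exact,
      because b m (a/b) = a m; the error is 0 there, which is below 1/N as N > 0.\<close>
    have "\<bar>real (b * m) * x $ j - of_int (if j = i then a * int m else p j)\<bar> < 1 / real N" for j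
      using p[of j] assms by (auto simp: coord_hyperplane_def mult_ac)
    then show "infnorm (real (b * m) *\<^sub>R x -
        (\<chi> j. real_of_int ((\<chi> j. if j = i then a * int m else p j) $ j))) < 1 / real N"
      by (simp add: infnorm_cart_less_iff)
  qed
qed

text \<open>Dirichlet solutions for different N may coincide, so infinitude is shown by
  contradiction: a finite set of solutions either contains no exact one, and then has a least
  positive error that a large N beats, or the multiples of an exact solution exceed it.\<close>

lemma approximable_if_frequently:
  fixes x :: "real ^ 'n"
  assumes x: "x \<in> coord_hyperplane i (of_int a / real b)" and b: "b > 0"
    and n: "CARD('n) \<ge> 2" and \<psi>: "approximating_function \<psi>"
    and freq: "\<exists>\<^sub>\<infinity>N. 1 / real N \<le> \<psi> (b * N ^ (CARD('n) - 1))"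
  shows "approximable \<psi> x"
proof -
  define err where "err = (\<lambda>(p :: int ^ 'n, q :: nat).
    infnorm (real q *\<^sub>R x - (\<chi> j. real_of_int (p $ j))))"
  define S where "S = {(p :: int ^ 'n, q :: nat). 1 \<le> q \<and> err (p, q) < \<psi> q}"
  have anti: "\<psi> s \<le> \<psi> r" if "1 \<le> r" "r \<le> s" for r s
    using \<psi> that by (auto simp: approximating_function_def monotone_on_def)
  have large: "\<exists>N>M. 1 / real N \<le> \<psi> (b * N ^ (CARD('n) - 1))" for M
    using freq by (auto simp: INFM_nat)
  \<comment> \<open>\<open>\<psi>\<close> is positive at arguments b N^(d-1) beyond any q, since the
    exponent is at least 1; monotonicity carries this down to q.\<close>
  have pos: "\<psi> q > 0" if "q \<ge> 1" for q
  proof -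
    obtain N where N: "N > q" "1 / real N \<le> \<psi> (b * N ^ (CARD('n) - 1))"
      using large by blast
    have "N \<le> N ^ (CARD('n) - 1)"
      using N(1) n by (intro self_le_power) auto
    also have "\<dots> \<le> b * N ^ (CARD('n) - 1)"
      using b by simp
    finally have "\<psi> (b * N ^ (CARD('n) - 1)) \<le> \<psi> q"
      using N(1) that by (intro anti) auto
    moreover have "0 < 1 / real N"
      using N(1) by simp
    ultimately show ?thesis
      using N(2) by linarith
  qed
  have "infinite S"
  proof
    assume fin: "finite S"
    show False
    proof (cases "\<exists>p q. 1 \<le> q \<and> err (p, q) = 0")
      case True
      then obtain p q where q: "1 \<le> q" and "err (p, q) = 0"
        by blast
      then have "real q *\<^sub>R x = (\<chi> j. real_of_int (p $ j))"
        by (simp add: err_def infnorm_eq_0)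
      then have eq: "real q * x $ j = real_of_int (p $ j)" for j
        by (simp add: vec_eq_iff)
      have "err (\<chi> j. int k * p $ j, k * q) = 0" for k
        by (simp add: err_def infnorm_eq_0 vec_eq_iff mult.assoc flip: eq)
      \<comment> \<open>By \<open>pos\<close>, error 0 suffices for membership; \<open>Suc k\<close>
        avoids the denominator 0.\<close>
      then have "(\<chi> j. int (Suc k) * p $ j, Suc k * q) \<in> S" for k
        using pos[of "Suc k * q"] q by (simp add: S_def del: mult_Suc of_nat_Suc)
      then have "range (\<lambda>k. (\<chi> j. int (Suc k) * p $ j, Suc k * q)) \<subseteq> S"
        by blast
      moreover have "inj (\<lambda>k. (\<chi> j. int (Suc k) * p $ j, Suc k * q))"
        using q by (auto simp: inj_on_def simp del: mult_Suc)
      ultimately show False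
        using fin by (meson finite_subset range_inj_infinite)
    next
      case False
      \<comment> \<open>Half of the least among 1 and the errors over \<open>S\<close>: halving
        makes the bound strict, and the 1 keeps the minimum defined if \<open>S\<close> is
        empty.\<close>
      have "\<exists>\<epsilon>>0. \<forall>s\<in>S. \<epsilon> < err s"
      proof (intro exI conjI ballI)
        let ?m = "Min (insert 1 (err ` S))"
        have "err s > 0" if "s \<in> S" for s
          using False that infnorm_pos_le
          by (cases s) (force simp: S_def err_def order_less_le)
        then show "?m / 2 > 0"
          using fin by simp
        fix s assume "s \<in> S"
        then have "?m \<le> err s"
          using fin by simp
        then show "?m / 2 < err s"
          using \<open>?m / 2 > 0\<close> by linarith
      qed
      then obtain \<epsilon> where \<epsilon>: "\<epsilon> > 0" "\<And>s. s \<in> S \<Longrightarrow> \<epsilon> < err s"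
        by blast
      obtain M where M: "inverse (real (Suc M)) < \<epsilon>"
        using reals_Archimedean[OF \<epsilon>(1)] by blast
      obtain N where N: "N > Suc M" "1 / real N \<le> \<psi> (b * N ^ (CARD('n) - 1))"
        using large by blast
      then obtain p q where q: "1 \<le> q" "q \<le> b * N ^ (CARD('n) - 1)"
        and p: "infnorm (real q *\<^sub>R x - (\<chi> j. real_of_int (p $ j))) < 1 / real N"
        using Dirichlet_approx_coord_hyperplane[OF x b] by (metis less_nat_zero_code neq0_conv)
      have lt: "err (p, q) < 1 / real N"
        using p by (simp add: err_def)
      also have "\<dots> \<le> \<psi> q"
        using N(2) anti[OF q] by linarith
      finally have "(p, q) \<in> S"
        using q by (simp add: S_def)
      moreover have "1 / real N < \<epsilon>"
      proof -
        have "1 / real N \<le> 1 / real (Suc M)"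
          using N(1) by (intro divide_left_mono) auto
        then show ?thesis
          using M by (simp add: inverse_eq_divide)
      qed
      ultimately show False
        using \<epsilon>(2) lt by fastforce
    qed
  qed
  moreover have "S = {(p, q). 1 \<le> q \<and> infnorm (real q *\<^sub>R x - (\<chi> j. real_of_int (p $ j))) < \<psi> q}"
    by (auto simp: S_def err_def)
  ultimately show ?thesis
    by (simp add: approximable_def)
qed

section \<open>The critical decay rate q^(-1/n)\<close>

text \<open>The exponent of q is -(n+1)/n < -1. This series serves both as the majorant in the
  divergence part and as the counterexample to convergence type.\<close>

lemma summable_powr_root:
  assumes "n \<ge> 1" and "b > 0"
  shows "summable (\<lambda>q. ((real b / real (Suc q)) powr (1 / real n)) ^ Suc n)"
proof -
  define s where "s = 1 / real n * real (Suc n)"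
  have "- s < -1"
    using assms by (simp add: s_def field_simps)
  then have "summable (\<lambda>q. real b powr s * real q powr (- s))"
    by (intro summable_mult) (simp add: summable_real_powr_iff)
  then have "summable (\<lambda>q. real b powr s * real (Suc q) powr (- s))"
    by (subst summable_Suc_iff)
  moreover have "((real b / real (Suc q)) powr (1 / real n)) ^ Suc n
      = real b powr s * real (Suc q) powr (- s)" for q
    using assms by (subst powr_power) (auto simp: s_def powr_divide powr_minus_divide mult.commute)
  ultimately show ?thesis
    by (simp only:)
qed

lemma frequently_ge_if_not_summable:
  assumes n: "n \<ge> 1" and b: "b > 0" and \<psi>: "approximating_function \<psi>"
    and div: "\<not> summable (\<lambda>q. \<psi> (Suc q) ^ Suc n)"
  shows "\<exists>\<^sub>\<infinity>N. 1 / real N \<le> \<psi> (b * N ^ n)"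
proof (rule ccontr)
  assume "\<not> ?thesis"
  then obtain M where M: "\<psi> (b * N ^ n) < 1 / real N" if "N > M" for N
    by (auto simp: INFM_nat not_le)
  have bound: "\<psi> q \<le> 2 * (real b / real q) powr (1 / real n)" if q: "q \<ge> b * Suc M ^ n" for q
  proof -
    \<comment> \<open>r solves b r^n = q and N is its floor, so b N^n \<le> q. The threshold on q
      makes r \<ge> M + 1, hence N > M.\<close>
    define r where "r = (real q / real b) powr (1 / real n)"
    define N where "N = nat \<lfloor>r\<rfloor>"
    have q0: "q \<ge> 1"
      using q b by (metis One_nat_def Suc_le_eq le_trans mult_pos_pos zero_less_Suc zero_less_power)
    have r_pow: "r ^ n = real q / real b"
      using n q0 b by (simp add: r_def powr_powr flip: powr_realpow)
    have "real (Suc M) ^ n \<le> r ^ n"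
      using of_nat_mono[OF q, where 'a = real] b by (simp add: r_pow field_simps)
    then have r: "real (Suc M) \<le> r"
      using n by (subst (asm) power_mono_iff) (auto simp: r_def)
    then have N: "N > M" "real N \<le> r" "r < real N + 1"
      by (auto simp: N_def) linarith+
    have "real N ^ n \<le> real q / real b"
      using N by (simp add: power_mono flip: r_pow)
    then have "real (b * N ^ n) \<le> real q"
      using b by (simp add: field_simps)
    then have "b * N ^ n \<le> q"
      by (simp only: of_nat_le_iff)
    moreover have "1 \<le> b * N ^ n"
      using b N(1) by (simp add: Suc_le_eq)
    ultimately have "\<psi> q \<le> \<psi> (b * N ^ n)"
      using \<psi> q0 by (auto simp: approximating_function_def monotone_on_def)
    also have "\<dots> < 1 / real N"
      using M N by blast
    \<comment> \<open>The factor 2 pays for the floor: r < N + 1 \<le> 2 N.\<close>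
    also have "\<dots> \<le> 2 * (1 / r)"
    proof -
      have "1 \<le> real N"
        using N(1) by simp
      then have "r \<le> 2 * real N"
        using N(3) by linarith
      then show ?thesis
        using N(1) r by (simp add: field_simps)
    qed
    also have "1 / r = (real b / real q) powr (1 / real n)"
      by (simp add: r_def powr_divide)
    finally show ?thesis
      by simp
  qed
  have "summable (\<lambda>q. \<psi> (Suc q) ^ Suc n)"
  proof (rule summable_comparison_test_ev)
    show "summable (\<lambda>q. 2 ^ Suc n * ((real b / real (Suc q)) powr (1 / real n)) ^ Suc n)"
      by (intro summable_mult summable_powr_root n b)
    show "\<forall>\<^sub>F q in sequentially. norm (\<psi> (Suc q) ^ Suc n)
        \<le> 2 ^ Suc n * ((real b / real (Suc q)) powr (1 / real n)) ^ Suc n"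
      using eventually_ge_at_top[of "b * Suc M ^ n"]
    proof eventually_elim
      case (elim q)
      have "0 \<le> \<psi> (Suc q)"
        using \<psi> by (simp add: approximating_function_def)
      then show ?case
        using bound[of "Suc q"] elim
        by (simp only: real_norm_def power_abs abs_of_nonneg flip: power_mult_distrib)
           (intro power_mono; simp)
    qed
  qed
  with div show False ..
qed

section \<open>Nontriviality of the measure, and both Khintchine properties\<close>

text \<open>Ensures that almost every and almost no point cannot both be approximable. The embedding
  pulls the hyperplane back to the whole product space, whose measure is a product of infinite
  factors.\<close>

lemma emeasure_coord_hyperplane_measure_space_neq_0:
  fixes i :: "'n::finite"
  shows "emeasure (coord_hyperplane_measure i c) (space (coord_hyperplane_measure i c)) \<noteq> 0"
proof -
  interpret product_sigma_finite "\<lambda>_ :: 'n. lborel :: real measure"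
    by standard
  let ?P = "\<Pi>\<^sub>M j\<in>UNIV - {i}. lborel :: real measure"
  have "emeasure (coord_hyperplane_measure i c) (space (coord_hyperplane_measure i c))
      = emeasure ?P (space ?P)"
    unfolding coord_hyperplane_measure_def space_distr
    by (subst emeasure_distr)
       (auto intro!: arg_cong[where f = "emeasure _"] measurable_coord_hyperplane_embed
         dest: measurable_space[OF measurable_coord_hyperplane_embed])
  also have "\<dots> = (\<Prod>j\<in>UNIV - {i}. emeasure lborel (UNIV :: real set))"
    using emeasure_PiM[of "UNIV - {i}" "\<lambda>_. UNIV"] by (simp add: space_PiM)
  also have "\<dots> \<noteq> 0"
    by (simp add: prod_zero_iff)
  finally show ?thesis .
qed

theorem mainTheorem6:
  fixes i :: "'n::finite" and c :: real
  assumes "CARD('n) \<ge> 2" and "c \<in> \<rat>"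
  shows "khintchine_type_divergence (coord_hyperplane_measure i c)
    \<and> \<not> khintchine_type_convergence (coord_hyperplane_measure i c)"
proof
  define n where "n = CARD('n) - 1"
  have n: "n \<ge> 1" and card: "CARD('n) = Suc n"
    using assms(1) by (auto simp: n_def)
  obtain a b where b: "b > 0" and c: "c = of_int a / of_int b"
    using \<open>c \<in> \<rat>\<close> by (auto elim: Rats_cases')
  have b': "nat b > 0" and c': "c = of_int a / real (nat b)"
    using b c by auto
  \<comment> \<open>In fact every point of the hyperplane is approximable, so no exceptional null
    set arises.\<close>
  have approx: "AE x in coord_hyperplane_measure i c. approximable \<psi> x"
    if "approximating_function \<psi>" "\<exists>\<^sub>\<infinity>N. 1 / real N \<le> \<psi> (nat b * N ^ n)" for \<psi>
    using approximable_if_frequently[OF _ b' assms(1) that(1)] that(2)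
    by (intro AE_I2) (simp add: n_def c')
  show "khintchine_type_divergence (coord_hyperplane_measure i c)"
    unfolding khintchine_type_divergence_def card
    using approx frequently_ge_if_not_summable[OF n b'] by blast
  show "\<not> khintchine_type_convergence (coord_hyperplane_measure i c)"
  proof
    assume conv: "khintchine_type_convergence (coord_hyperplane_measure i c)"
    \<comment> \<open>The borderline choice: it solves \<psi>(b N^n) = 1/N exactly.\<close>
    define \<psi> where "\<psi> q = (real (nat b) / real q) powr (1 / real n)" for q
    have \<psi>: "approximating_function \<psi>"
      unfolding approximating_function_def \<psi>_def
      by (auto intro!: monotone_onI powr_mono2 divide_left_mono)
    have "summable (\<lambda>q. \<psi> (Suc q) ^ CARD('n))"
      unfolding card \<psi>_def using summable_powr_root[OF n b'] .
    with conv \<psi> have "AE x in coord_hyperplane_measure i c. \<not> approximable \<psi> x"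
      by (auto simp: khintchine_type_convergence_def)
    \<comment> \<open>At N = 0 both sides are 0: division by zero gives 0, the argument is 0 as n
      \<ge> 1, and 0 \<open>powr\<close> anything is 0.\<close>
    moreover have "1 / real N = \<psi> (nat b * N ^ n)" for N
      using n b by (cases "N = 0") (auto simp: \<psi>_def powr_divide powr_powr simp flip: powr_realpow)
    then have "AE x in coord_hyperplane_measure i c. approximable \<psi> x"
      by (intro approx \<psi>) (auto simp: INFM_nat)
    \<comment> \<open>The two conclusions together make the whole hyperplane a null set.\<close>
    ultimately have "AE x in coord_hyperplane_measure i c. False"
      by eventually_elim simp
    then show False
      using emeasure_coord_hyperplane_measure_space_neq_0[of i c]
      by (simp add: AE_iff_measurable[OF sets.top])
  qed
qed

end
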